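(* (1) Let $a,b$ be positive coprime integers and let $\{m\}_n$ be the Euclidean design of $a$ generated by $b$. Then $a=[2^n:m]$ and $b=[2^n:2^n-m]$. In particular, if $(a,b)=(1,1)$ then $(m,n)=(1,1)$. (2) Let $m,n$ be positive integers with $m$ odd, $1\le m\le 2^n-1$ and $(m,n)\ne(1,1)$, and write the binary word $\{m\}_n=1^{k_0}0^{k_1}\cdots 0^{k_{l-2}}1^{k_{l-1}}$ with $l$ odd, $k_0\ge 0$ and $k_i\ge 1$ for $i=1,\dots,l-1$. (i) If $m\equiv 3 \pmod 4$ (i.e. $k_{l-1}\ge 2$), put $t=l$ and $r_i=k_i$ for $i=0,\dots,t-1$. Then the realizing pair $(a,b)$ of $r_0,\dots,r_{t-1}$ exists, and $\{m\}_n$ is the Euclidean design of $a$ generated by $b$. (ii) If $m\equiv 1\pmod 4$ (i.e. $k_{l-1}=1$), put $t=l-1$, $r_i=k_i$ for $i=0,\dots,t-2$, and $r_{t-1}=k_{l-2}+1$. Then the realizing pair $(a,b)$ of $r_0,\dots,r_{t-1}$ exists, and $\{m\}_n$ is the Euclidean design of $a$ generated by $b$.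
   Context: Stern's diatomic integers: for integers $n\ge0$, $0\le m\le 2^n$, define $[2^0:0]=0$, $[2^0:1]=1$, $[2^{n+1}:2m]=[2^n:m]$ ($0\le m\le 2^n$), $[2^{n+1}:2m+1]=[2^n:m]+[2^n:m+1]$ ($0\le m\le 2^n-1$). Designs: for $0\le m\le 2^n-1$, $\{m\}_n$ denotes the binary word $d_1d_2\cdots d_n$ of length $n$ (leading zeros allowed) with $\sum_{i=1}^n 2^{n-i}d_i=m$. We write $x^k$ for $k$ consecutive copies of the letter $x$. Partial quotients: for positive coprime integers $a,b$, run the Euclidean algorithm $c_{i-2}=c_{i-1}r_i+c_i$ ($i=0,1,\dots,t-1$) with $c_{-2}=a$, $c_{-1}=b$, integers $0\le c_i<c_{i-1}$, terminating with $c_{t-2}=1$, $c_{t-1}=0$ ($t\ge1$); then $r_0\ge0$, $r_i\ge 1$ ($i\ge1$), and $r_0,\dots,r_{t-1}$ are called the partial quotients of $a$ generated by $b$. For any sequence of integers $r_0\ge0$, $r_1,\dots,r_{t-2}\ge1$, $r_{t-1}\ge2$ there is a unique pair $(a,b)$ of positive coprime integers whose partial quotients are $r_0,\dots,r_{t-1}$; it is called the realizing pair of the sequence. Euclidean design: for positive coprime $a,b$ with partial quotients $r_0,\dots,r_{t-1}$ and $n=\sum r_i$, the Euclidean design of $a$ generated by $b$ is the word $1$ (i.e. $\{1\}_1$) if $(a,b)=(1,1)$; the word $1^{r_0}0^{r_1}1^{r_2}\cdots 0^{r_{t-2}}1^{r_{t-1}}$ if $(a,b)\neq(1,1)$ and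 $t$ is odd; and the word $1^{r_0}0^{r_1}\cdots 1^{r_{t-2}}0^{r_{t-1}-1}1$ if $(a,b)\neq(1,1)$ and $t$ is even. Writing it as $\{m\}_n$, $m$ is called the design number. *)

theory Defs
  imports Main
begin

text \<open>\<open>stern n m\<close> is Stern's integer \<open>[2^n : m]\<close>; only the values with \<open>m \<le> 2 ^ n\<close> are meaningful.\<close>

fun stern :: "nat \<Rightarrow> nat \<Rightarrow> nat" where
  "stern 0 m = (if m = 0 then 0 else 1)"
| "stern (Suc n) m =
     (if even m then stern n (m div 2) else stern n (m div 2) + stern n (m div 2 + 1))"

text \<open>\<open>design m n\<close> is the word \<open>{m}\<^sub>n\<close>, for \<open>m < 2 ^ n\<close>; the letter \<open>d\<^sub>i\<close> is \<open>w ! (i - 1)\<close>.\<close>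

definition binary_word_of :: "nat \<Rightarrow> nat \<Rightarrow> nat list \<Rightarrow> bool" where
  "binary_word_of m n w \<longleftrightarrow>
     length w = n \<and> set w \<subseteq> {0, 1} \<and> (\<Sum>i = 1..n. 2 ^ (n - i) * w ! (i - 1)) = m"

definition design :: "nat \<Rightarrow> nat \<Rightarrow> nat list" where
  "design m n = (THE w. binary_word_of m n w)"

lemma binary_word_of_snoc:
  "binary_word_of m (Suc n) (w @ [d]) \<longleftrightarrow>
     d \<in> {0, 1} \<and> (\<exists>m'. binary_word_of m' n w \<and> m = 2 * m' + d)"
proof -
  have "(\<Sum>i = 1..Suc n. 2 ^ (Suc n - i) * (w @ [d]) ! (i - 1))
      = 2 * (\<Sum>i = 1..n. 2 ^ (n - i) * w ! (i - 1)) + d" if "length w = n"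
  proof -
    have "(\<Sum>i = 1..n. 2 ^ (Suc n - i) * (w @ [d]) ! (i - 1))
        = (\<Sum>i = 1..n. 2 * (2 ^ (n - i) * w ! (i - 1)))"
      using that by (intro sum.cong) (auto simp: nth_append Suc_diff_le)
    then show ?thesis
      using that by (simp add: sum_distrib_left nth_append)
  qed
  then show ?thesis
    by (auto simp: binary_word_of_def)
qed

lemma binary_word_of_ex1:
  assumes "m < 2 ^ n"
  shows "\<exists>!w. binary_word_of m n w"
  using assms
proof (induction n arbitrary: m)
  case 0
  then show ?case by (auto simp: binary_word_of_def)
next
  case (Suc n)
  then have "m div 2 < 2 ^ n" by auto
  with Suc.IH obtain w where w: "binary_word_of (m div 2) n w"
    and uniq: "\<And>v. binary_word_of (m div 2) n v \<Longrightarrow> v = w" by blast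
  show ?case
  proof (rule ex1I)
    show "binary_word_of m (Suc n) (w @ [m mod 2])"
      using w by (auto simp: binary_word_of_snoc intro!: exI[of _ "m div 2"])
  next
    fix v assume v: "binary_word_of m (Suc n) v"
    then have "v \<noteq> []" by (auto simp: binary_word_of_def)
    then obtain u d where ud: "v = u @ [d]" by (metis rev_exhaust)
    with v obtain m' where "d \<in> {0, 1}" "binary_word_of m' n u" "m = 2 * m' + d"
      by (auto simp: binary_word_of_snoc)
    then have "m div 2 = m'" "m mod 2 = d" by auto
    with \<open>binary_word_of m' n u\<close> uniq ud show "v = w @ [m mod 2]" by auto
  qed
qed

lemma binary_word_of_design: "m < 2 ^ n \<Longrightarrow> binary_word_of m n (design m n)"
  unfolding design_def by (rule theI') (rule binary_word_of_ex1)

text \<open>The word \<open>1^{k\<^sub>0} 0^{k\<^sub>1} 1^{k\<^sub>2} \<dots>\<close> for \<open>ks = [k\<^sub>0, k\<^sub>1, k\<^sub>2, \<dots>]\<close>.\<close>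

definition block_word :: "nat list \<Rightarrow> nat list" where
  "block_word ks =
     concat (map (\<lambda>i. replicate (ks ! i) (if even i then 1 else 0)) [0..<length ks])"

text \<open>The Euclidean algorithm with \<open>c\<^sub>-\<^sub>2 = a\<close>, \<open>c\<^sub>-\<^sub>1 = b\<close>; it returns \<open>[r\<^sub>0, \<dots>, r\<^bsub>t-1\<^esub>]\<close>.\<close>

fun partial_quotients :: "nat \<Rightarrow> nat \<Rightarrow> nat list" where
  "partial_quotients a b =
     (if b = 0 then [] else (a div b) # partial_quotients b (a mod b))"

declare partial_quotients.simps [simp del]

definition admissible :: "nat list \<Rightarrow> bool" where
  "admissible rs \<longleftrightarrow>
     rs \<noteq> [] \<and> (\<forall>i. 1 \<le> i \<and> i + 1 < length rs \<longrightarrow> 1 \<le> rs ! i) \<and> 2 \<le> last rs"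

definition realizing_pair :: "nat list \<Rightarrow> nat \<times> nat \<Rightarrow> bool" where
  "realizing_pair rs p \<longleftrightarrow>
     admissible rs \<and> 0 < fst p \<and> 0 < snd p \<and> coprime (fst p) (snd p) \<and>
     partial_quotients (fst p) (snd p) = rs"

definition euclidean_design :: "nat \<Rightarrow> nat \<Rightarrow> nat list" where
  "euclidean_design a b =
     (let rs = partial_quotients a b in
      if (a, b) = (1, 1) then [1]
      else if odd (length rs) then block_word rs
      else block_word (butlast rs @ [last rs - 1]) @ [1])"

text \<open>\<open>w = 1^{k\<^sub>0} 0^{k\<^sub>1} \<dots> 1^{k\<^bsub>l-1\<^esub>}\<close> with \<open>l\<close> odd, where only \<open>k\<^sub>0\<close> may vanish.\<close>

definition block_lengths :: "nat list \<Rightarrow> nat list \<Rightarrow> bool" where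
  "block_lengths w ks \<longleftrightarrow>
     odd (length ks) \<and> (\<forall>i. 1 \<le> i \<and> i < length ks \<longrightarrow> 1 \<le> ks ! i) \<and> w = block_word ks"

end

theory Submission
  imports Defs
begin

text \<open>
  For a word of length \<open>n\<close> and value \<open>m\<close> consider the pair \<open>([2^n : m], [2^n : 2^n - m])\<close>.
  Prepending the letter \<open>1\<close> turns \<open>(a, b)\<close> into \<open>(a + b, b)\<close>, and prepending \<open>0\<close> turns it into
  \<open>(a, a + b)\<close>, because \<open>[2^(n+1) : m] = [2^n : m]\<close> and
  \<open>[2^(n+1) : 2^n + m] = [2^n : m] + [2^n : 2^n - m]\<close>.
  A block \<open>1^r\<close> therefore undoes one division step with quotient \<open>r\<close>, a block \<open>0^r\<close> does the same
  with the roles of \<open>a\<close> and \<open>b\<close> exchanged, and reading the Euclidean design from right to left runs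
  the Euclidean algorithm backwards. Both shapes of the Euclidean design agree with the block word of
  the partial quotients, the last one lowered by one, followed by a final letter \<open>1\<close>.
\<close>

section \<open>Stern's integers under a new leading binary digit\<close>

lemma stern_Suc_eq: "m \<le> 2 ^ n \<Longrightarrow> stern (Suc n) m = stern n m"
proof (induction n arbitrary: m)
  case 0
  then have "m = 0 \<or> m = 1" by auto
  then show ?case by auto
next
  case (Suc n)
  then have "m div 2 \<le> 2 ^ n" by auto
  \<comment> \<open>An odd \<open>m\<close> cannot equal the even bound, so its upper neighbour
    after halving is still in range for the induction hypothesis.\<close>
  moreover have "m div 2 + 1 \<le> 2 ^ n" if "odd m"
    using Suc.prems that by (auto elim!: oddE)
  ultimately show ?case
    using Suc.IH by (simp del: stern.simps add: stern.simps(2)[of "Suc n"] stern.simps(2)[of n m])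
qed

text \<open>The defining recursion strips the last digit, whereas this rule concerns the leading
  one. It follows by induction because both sides obey the same last-digit recursion.\<close>

lemma stern_add_power:
  "m \<le> 2 ^ n \<Longrightarrow> stern (Suc n) (2 ^ n + m) = stern n m + stern n (2 ^ n - m)"
proof (induction n arbitrary: m)
  case 0
  then have "m = 0 \<or> m = 1" by auto
  then show ?case by auto
next
  case (Suc n)
  show ?case
  proof (cases "even m")
    case True
    then obtain j where m: "m = 2 * j" by (elim evenE)
    have "stern (Suc (Suc n)) (2 ^ Suc n + m) = stern (Suc n) (2 ^ n + j)"
      by (subst stern.simps(2)) (simp add: m)
    moreover have "stern (Suc n) m = stern n j"
      by (simp add: m)
    moreover have "2 ^ Suc n - m = 2 * (2 ^ n - j)"
      by (simp add: m)
    then have "stern (Suc n) (2 ^ Suc n - m) = stern n (2 ^ n - j)"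
      by simp
    ultimately show ?thesis
      using Suc.IH[of j] Suc.prems m by simp
  next
    case False
    then obtain j where m: "m = 2 * j + 1" by (elim oddE)
    have j: "j + 1 \<le> 2 ^ n" using Suc.prems m by simp
    have "stern (Suc (Suc n)) (2 ^ Suc n + m)
        = stern (Suc n) (2 ^ n + j) + stern (Suc n) (2 ^ n + (j + 1))"
      by (subst stern.simps(2)) (simp add: m del: stern.simps)
    moreover have "stern (Suc n) m = stern n j + stern n (j + 1)"
      by (simp add: m)
    \<comment> \<open>Reflection exchanges the two neighbours: \<open>j + 1\<close> yields the lower
      half of the reflected argument and \<open>j\<close> the upper one.\<close>
    moreover have "2 ^ Suc n - m = 2 * (2 ^ n - (j + 1)) + 1"
      using j m by simp
    then have "stern (Suc n) (2 ^ Suc n - m) = stern n (2 ^ n - (j + 1)) + stern n (2 ^ n - j)"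
      using j by (simp add: Suc_diff_Suc)
    ultimately show ?thesis
      using Suc.IH[of j] Suc.IH[of "j + 1"] j by simp
  qed
qed

section \<open>Words acting on pairs\<close>

fun word_act :: "nat list \<Rightarrow> nat \<times> nat \<Rightarrow> nat \<times> nat" where
  "word_act [] p = p"
| "word_act (d # w) p =
     (case word_act w p of (a, b) \<Rightarrow> if d = 0 then (a, a + b) else (a + b, b))"

lemma word_act_append: "word_act (u @ v) p = word_act u (word_act v p)"
  by (induction u) auto

lemma word_act_replicate_1: "word_act (replicate r 1) (a, b) = (a + r * b, b)"
  by (induction r) auto

text \<open>Exchanging the letters conjugates the action by the swap of coordinates, so blocks of
  zeros reduce to blocks of ones.\<close>

lemma word_act_complement:
  "set w \<subseteq> {0, 1} \<Longrightarrow> word_act (map (\<lambda>d. 1 - d) w) (b, a) = prod.swap (word_act w (a, b))"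
  by (induction w) (auto split: prod.splits)

lemma binary_word_of_less: "binary_word_of m n w \<Longrightarrow> m < 2 ^ n"
proof (induction w arbitrary: m n rule: rev_induct)
  case Nil
  then show ?case by (auto simp: binary_word_of_def)
next
  case (snoc d w)
  then obtain k where n: "n = Suc k" by (auto simp: binary_word_of_def)
  with snoc show ?case by (fastforce simp: binary_word_of_snoc)
qed

text \<open>Splits off the leading digit, as \<open>word_act\<close> recurses from the left;
  \<open>binary_word_of_snoc\<close> treats the other end.\<close>

lemma binary_word_of_Cons:
  assumes "binary_word_of m (Suc n) (d # w)"
  obtains m' where "d \<in> {0, 1}" "binary_word_of m' n w" "m = d * 2 ^ n + m'"
proof -
  define m' where "m' = (\<Sum>i = 1..n. 2 ^ (n - i) * w ! (i - 1))"
  have "(\<Sum>i = 1..Suc n. 2 ^ (Suc n - i) * (d # w) ! (i - 1)) = d * 2 ^ n + m'"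
    unfolding m'_def
    by (subst sum.atLeast_Suc_atMost, simp, subst sum.shift_bounds_cl_Suc_ivl)
      (auto intro!: sum.cong simp: nth_Cons')
  with assms that[of m'] show ?thesis
    by (auto simp: binary_word_of_def m'_def)
qed

text \<open>The start \<open>(0, 1)\<close> is the pair of Stern values belonging to the empty word.
  Each further leading letter leaves one entry unchanged by \<open>stern_Suc_eq\<close> and replaces
  the other by the sum, by \<open>stern_add_power\<close>.\<close>

lemma word_act_stern:
  "binary_word_of m n w \<Longrightarrow> word_act w (0, 1) = (stern n m, stern n (2 ^ n - m))"
proof (induction w arbitrary: m n)
  case Nil
  then show ?case by (auto simp: binary_word_of_def)
next
  case (Cons d w)
  then obtain k where n: "n = Suc k" by (auto simp: binary_word_of_def)
  obtain m' where d: "d \<in> {0, 1}" and w: "binary_word_of m' k w" and m: "m = d * 2 ^ k + m'"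
    using Cons.prems unfolding n by (rule binary_word_of_Cons)
  note IH = Cons.IH[OF w]
  have le: "m' \<le> 2 ^ k" using binary_word_of_less[OF w] by simp
  show ?case
  proof (cases "d = 0")
    case True
    \<comment> \<open>With a leading 0 it is the reflected argument that gains \<open>2 ^ k\<close>,
      so the sum appears in the second entry.\<close>
    have "2 ^ n - m = 2 ^ k + (2 ^ k - m')" using le n m True by simp
    then show ?thesis
      using True IH n m le stern_Suc_eq[OF le] stern_add_power[of "2 ^ k - m'" k]
      by (simp del: stern.simps)
  next
    case False
    then have "d = 1" using d by simp
    moreover from this have "2 ^ n - m = 2 ^ k - m'" using n m by simp
    ultimately show ?thesis
      using IH n m le stern_Suc_eq[of "2 ^ k - m'" k] stern_add_power[OF le]
      by (simp del: stern.simps)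
  qed
qed

section \<open>Block words\<close>

lemma block_word_Nil [simp]: "block_word [] = []"
  by (simp add: block_word_def)

lemma block_word_snoc:
  "block_word (ks @ [k]) = block_word ks @ replicate k (if even (length ks) then 1 else 0)"
proof -
  have "map (\<lambda>i. replicate ((ks @ [k]) ! i) (if even i then 1 else 0)) [0..<length ks]
      = map (\<lambda>i. replicate (ks ! i) (if even i then 1 else 0 :: nat)) [0..<length ks]"
    by (auto simp: nth_append)
  then show ?thesis
    by (simp add: block_word_def del: map_eq_conv)
qed

lemma block_word_snoc_Suc:
  "block_word (ks @ [Suc k]) = block_word (ks @ [k]) @ [if even (length ks) then 1 else 0]"
  by (simp add: block_word_snoc replicate_append_same)

lemma set_block_word: "set (block_word ks) \<subseteq> {0, 1}"
  by (auto simp: block_word_def split: if_splits)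

text \<open>Removing the first block shifts the parity of all later indices, hence the
  complement.\<close>

lemma block_word_Cons:
  "block_word (k # ks) = replicate k 1 @ map (\<lambda>d. 1 - d) (block_word ks)"
proof (induction ks rule: rev_induct)
  case Nil
  show ?case using block_word_snoc[of "[]" k] by simp
next
  case (snoc x xs)
  then show ?case
    using block_word_snoc[of "k # xs" x] by (simp add: block_word_snoc)
qed

section \<open>Euclidean designs rebuild their pair\<close>

lemma partial_quotients_rec:
  "0 < b \<Longrightarrow> partial_quotients a b = (a div b) # partial_quotients b (a mod b)"
  by (subst partial_quotients.simps) simp

lemma partial_quotients_0 [simp]: "partial_quotients a 0 = []"
  by (subst partial_quotients.simps) simp

lemma partial_quotients_eq_Nil_iff [simp]: "partial_quotients a b = [] \<longleftrightarrow> b = 0"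
  by (subst partial_quotients.simps) simp

text \<open>The last quotient comes from an exact division of a positive number. Hence
  \<open>last rs - 1\<close> below is a true subtraction.\<close>

lemma last_partial_quotients_pos:
  "0 < a \<Longrightarrow> 0 < b \<Longrightarrow> 0 < last (partial_quotients a b)"
proof (induction a b rule: partial_quotients.induct)
  case (1 a b)
  show ?case
  proof (cases "a mod b = 0")
    case True
    then show ?thesis
      using 1 by (auto simp: partial_quotients_rec[of b a] div_greater_zero_iff dvd_imp_le mod_eq_0_iff_dvd)
  next
    case False
    then show ?thesis
      using 1 by (simp add: partial_quotients_rec[of b a])
  qed
qed

text \<open>For an odd number of quotients the last block consists of ones, and one of them is split
  off. For \<open>(1, 1)\<close> the lowered list is \<open>[0]\<close>, whose word is
  empty.\<close>

lemma euclidean_design_eq: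
  assumes "0 < a" "0 < b"
  shows "euclidean_design a b =
    (let rs = partial_quotients a b in block_word (butlast rs @ [last rs - 1]) @ [1])"
proof -
  define rs where "rs = partial_quotients a b"
  have ne: "rs \<noteq> []" and pos: "0 < last rs"
    using assms last_partial_quotients_pos by (auto simp: rs_def)
  consider "(a, b) = (1, 1)" | "(a, b) \<noteq> (1, 1)" "odd (length rs)"
    | "(a, b) \<noteq> (1, 1)" "even (length rs)" by blast
  then show ?thesis
  proof cases
    case 1
    then show ?thesis
      by (simp add: euclidean_design_def partial_quotients_rec block_word_def)
  next
    case 2
    obtain us u where rs: "rs = us @ [Suc u]"
      using ne pos by (metis append_butlast_last_id Suc_pred)
    then have "block_word rs = block_word (us @ [u]) @ [1]"
      using 2 by (simp add: block_word_snoc_Suc)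
    then show ?thesis
      using 2 rs by (auto simp: euclidean_design_def Let_def simp flip: rs_def)
  next
    case 3
    then show ?thesis by (auto simp: euclidean_design_def Let_def simp flip: rs_def)
  qed
qed

text \<open>Induction along the Euclidean algorithm. The start \<open>(1, 1)\<close> is symmetric,
  so complementing the word for \<open>(b, a mod b)\<close> gives \<open>(a mod b, b)\<close>, and
  \<open>a div b\<close> further ones add the missing multiple of \<open>b\<close>.\<close>

lemma word_act_partial_quotients:
  "0 < a \<Longrightarrow> 0 < b \<Longrightarrow> coprime a b \<Longrightarrow> rs = partial_quotients a b \<Longrightarrow>
     word_act (block_word (butlast rs @ [last rs - 1])) (1, 1) = (a, b)"
proof (induction a b arbitrary: rs rule: partial_quotients.induct)
  case (1 a b)
  show ?case
  proof (cases "a mod b = 0")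
    case True
    \<comment> \<open>Exact division: \<open>b\<close> is a common divisor, and \<open>a - 1\<close>
      ones lead from \<open>(1, 1)\<close> to \<open>(a, 1)\<close>.\<close>
    then have "b = 1" using 1 by (metis coprime_common_divisor_nat dvd_refl mod_eq_0_iff_dvd)
    then show ?thesis
      using 1 word_act_replicate_1[of "a - 1" 1 1]
      by (simp add: partial_quotients_rec block_word_Cons)
  next
    case False
    define rs' where "rs' = partial_quotients b (a mod b)"
    have "coprime b (a mod b)"
      using 1 by (simp add: coprime_commute)
    then have "word_act (block_word (butlast rs' @ [last rs' - 1])) (1, 1) = (b, a mod b)"
      using 1 False by (simp add: rs'_def)
    then have "word_act (map (\<lambda>d. 1 - d) (block_word (butlast rs' @ [last rs' - 1]))) (1, 1)
        = (a mod b, b)"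
      using set_block_word by (subst word_act_complement) auto
    moreover have "rs = (a div b) # rs'" "rs' \<noteq> []"
      using 1 False by (simp_all add: partial_quotients_rec[of b a] rs'_def)
    ultimately show ?thesis
      using word_act_replicate_1[of "a div b" "a mod b" b]
      by (simp add: block_word_Cons word_act_append)
  qed
qed

text \<open>The final letter 1 turns \<open>(0, 1)\<close> into the symmetric start
  \<open>(1, 1)\<close>.\<close>

lemma word_act_euclidean_design:
  assumes "0 < a" "0 < b" "coprime a b"
  shows "word_act (euclidean_design a b) (0, 1) = (a, b)"
  using word_act_partial_quotients[OF assms refl] assms
  by (simp add: euclidean_design_eq Let_def word_act_append)

section \<open>Existence and uniqueness of the realizing pair\<close>

lemma partial_quotients_inject:
  "0 < b \<Longrightarrow> 0 < b' \<Longrightarrow> coprime a b \<Longrightarrow> coprime a' b' \<Longrightarrow>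
     partial_quotients a b = partial_quotients a' b' \<Longrightarrow> a = a' \<and> b = b'"
proof (induction a b arbitrary: a' b' rule: partial_quotients.induct)
  case (1 a b)
  have q: "a div b = a' div b'"
    and r: "partial_quotients b (a mod b) = partial_quotients b' (a' mod b')"
    using "1.prems" by (simp_all add: partial_quotients_rec[of b a] partial_quotients_rec[of b' a'])
  have "b = b' \<and> a mod b = a' mod b'"
  proof (cases "a mod b = 0")
    case True
    with r have "a' mod b' = 0" by (metis partial_quotients_eq_Nil_iff)
    moreover from this True have "b = 1" "b' = 1"
      using "1.prems" by (metis coprime_common_divisor_nat dvd_refl mod_eq_0_iff_dvd)+
    ultimately show ?thesis using True by simp
  next
    case False
    with r have "a' mod b' \<noteq> 0" by (metis partial_quotients_eq_Nil_iff)
    have "coprime b (a mod b)" "coprime b' (a' mod b')"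
      using "1.prems" by (simp_all add: coprime_commute)
    with False r \<open>a' mod b' \<noteq> 0\<close> "1.prems"(1) show ?thesis
      by (intro "1.IH") simp_all
  qed
  with q show ?case by (metis div_mult_mod_eq)
qed

lemma partial_quotients_1_1: "partial_quotients (Suc 0) (Suc 0) = [1]"
  by (simp add: partial_quotients_rec)

text \<open>The algorithm is run backwards: a pair \<open>(b, c)\<close> for the tail gives
  \<open>(r * b + c, b)\<close>, provided that \<open>c < b\<close>, so that \<open>c\<close> really
  is the remainder.\<close>

lemma partial_quotients_surj:
  "rs \<noteq> [] \<Longrightarrow> \<forall>x\<in>set (tl rs). 1 \<le> x \<Longrightarrow> 2 \<le> last rs \<Longrightarrow>
     \<exists>a b. 0 < a \<and> 0 < b \<and> coprime a b \<and> partial_quotients a b = rs"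
proof (induction rs)
  case Nil
  then show ?case by simp
next
  case (Cons r rs)
  show ?case
  proof (cases "rs = []")
    case True
    then show ?thesis
      using Cons.prems by (intro exI[of _ r] exI[of _ 1]) (simp add: partial_quotients_rec)
  next
    case False
    have "\<forall>x\<in>set (tl rs). 1 \<le> x"
      using Cons.prems False by (auto dest: list.set_sel(2))
    then obtain b c where bc: "0 < b" "0 < c" "coprime b c" "partial_quotients b c = rs"
      using Cons.IH Cons.prems False by auto
    have "b div c = hd rs"
      using bc by (auto simp: partial_quotients_rec[of c b])
    then have "c \<le> b"
      using Cons.prems False bc by (metis div_greater_zero_iff hd_in_set less_eq_Suc_le list.sel(3) One_nat_def)
    \<comment> \<open>Equal coprime numbers are both 1, and their quotient list \<open>[1]\<close>
      violates the bound on the last entry.\<close>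
    moreover have "c \<noteq> b"
      using bc Cons.prems False by (auto simp: partial_quotients_1_1)
    ultimately have "c < b" by simp
    then have "partial_quotients (r * b + c) b = r # rs"
      using bc by (simp add: partial_quotients_rec[of b "r * b + c"])
    moreover have "coprime (r * b + c) b"
      using bc(3) by (simp add: coprime_iff_gcd_eq_1 gcd.commute[of _ b] gcd_add_mult)
    ultimately show ?thesis
      using bc by (intro exI[of _ "r * b + c"] exI[of _ b]) simp
  qed
qed

lemma realizing_pair_ex1:
  assumes "rs \<noteq> []" "\<And>i. 1 \<le> i \<Longrightarrow> i < length rs \<Longrightarrow> 1 \<le> rs ! i" "2 \<le> last rs"
  shows "\<exists>!p. realizing_pair rs p"
proof -
  have "\<forall>x\<in>set (tl rs). 1 \<le> x"
    using assms(2) by (auto simp: in_set_conv_nth nth_tl)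
  then obtain a b where "0 < a" "0 < b" "coprime a b" "partial_quotients a b = rs"
    using partial_quotients_surj[OF assms(1) _ assms(3)] by metis
  moreover have "admissible rs"
    using assms by (auto simp: admissible_def)
  ultimately have "realizing_pair rs (a, b)"
    by (simp add: realizing_pair_def)
  then show ?thesis
    by (rule ex1I) (use \<open>realizing_pair rs (a, b)\<close> partial_quotients_inject
        in \<open>auto simp: realizing_pair_def prod_eq_iff\<close>)
qed

section \<open>Decomposing a binary word into blocks\<close>

lemma block_word_exists:
  "set w \<subseteq> {0, 1} \<Longrightarrow>
     \<exists>ks k. w = block_word (ks @ [k]) \<and>
       (\<forall>i. 1 \<le> i \<and> i < length (ks @ [k]) \<longrightarrow> 1 \<le> (ks @ [k]) ! i)"
proof (induction w rule: rev_induct)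
  case Nil
  \<comment> \<open>Only the first block may be empty, so the empty word is represented by
    \<open>[0]\<close>; each new letter then lengthens the last block or opens a new one.\<close>
  show ?case by (intro exI[of _ "[]"] exI[of _ 0]) (simp add: block_word_def)
next
  case (snoc d w)
  then obtain ks k where w: "w = block_word (ks @ [k])"
    and pos: "\<And>i. 1 \<le> i \<Longrightarrow> i < length (ks @ [k]) \<Longrightarrow> 1 \<le> (ks @ [k]) ! i"
    by auto
  show ?case
  proof (cases "d = (if even (length ks) then 1 else 0)")
    case True
    then have "w @ [d] = block_word (ks @ [Suc k])"
      using w by (simp add: block_word_snoc_Suc)
    moreover have "1 \<le> (ks @ [Suc k]) ! i" if "1 \<le> i" "i < length (ks @ [Suc k])" for i
      using pos[of i] that by (auto simp: nth_append split: if_splits)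
    ultimately show ?thesis by blast
  next
    case False
    then have "w @ [d] = block_word ((ks @ [k]) @ [1])"
      using w snoc.prems unfolding block_word_snoc[of "ks @ [k]" 1] by auto
    moreover have "1 \<le> ((ks @ [k]) @ [1]) ! i" if "1 \<le> i" "i < length ((ks @ [k]) @ [1])" for i
      using pos[of i] that nth_append[of "ks @ [k]" "[1]" i] by (cases "i = Suc (length ks)") auto
    ultimately show ?thesis by blast
  qed
qed

text \<open>Once the last block is known to be nonempty, the final letter 1 forces its index to be
  even, so the number of blocks is odd.\<close>

lemma block_lengths_exists:
  assumes "set w \<subseteq> {0, 1}" "w \<noteq> []" "last w = 1"
  shows "\<exists>ks. block_lengths w ks"
proof -
  obtain ks k where w: "w = block_word (ks @ [k])"
    and pos: "\<And>i. 1 \<le> i \<Longrightarrow> i < length (ks @ [k]) \<Longrightarrow> 1 \<le> (ks @ [k]) ! i"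
    using block_word_exists[OF assms(1)] by blast
  have "k \<noteq> 0"
  proof (cases "ks = []")
    case True
    then show ?thesis using w assms(2) block_word_snoc[of "[]" k] by auto
  next
    case False
    then show ?thesis using pos[of "length ks"] by (simp add: Suc_le_eq)
  qed
  then have "even (length ks)"
    using assms(3) unfolding w block_word_snoc by (simp split: if_splits)
  with w pos show ?thesis
    by (intro exI[of _ "ks @ [k]"]) (auto simp: block_lengths_def)
qed

text \<open>The last two letters, \<open>11\<close> or \<open>01\<close>, separate the residues 3
  and 1 modulo 4.\<close>

lemma block_lengths_cases:
  assumes "block_lengths w ks" "2 \<le> length w" "last w = 1"
  obtains (two) us k where "ks = us @ [Suc (Suc k)]" "w = block_word (us @ [k]) @ [1, 1]"
  | (one) us j where "ks = us @ [Suc j, 1]" "w = block_word (us @ [j]) @ [0, 1]" "odd (length us)"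
proof -
  have odd: "odd (length ks)" and w: "w = block_word ks"
    and pos: "\<And>i. 1 \<le> i \<Longrightarrow> i < length ks \<Longrightarrow> 1 \<le> ks ! i"
    using assms(1) by (auto simp: block_lengths_def)
  obtain vs k where ks: "ks = vs @ [k]"
    using odd by (metis list.size(3) even_zero rev_exhaust)
  have ev: "even (length vs)" using odd ks by simp
  show ?thesis
  proof (cases "vs = []")
    case True
    then have "2 \<le> k" using assms(2) w ks by (simp add: block_word_snoc[of "[]", simplified])
    then obtain k' where "k = Suc (Suc k')" by (metis Suc_le_D numeral_2_eq_2 Suc_le_mono)
    then show ?thesis
      using two[of vs k'] w ks ev by (simp add: block_word_snoc_Suc)
  next
    case False
    then obtain us j' where vs: "vs = us @ [j']" by (metis rev_exhaust)
    have "1 \<le> k" using pos[of "length vs"] False ks by (cases vs) (auto simp: nth_append)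
    show ?thesis
    proof (cases "k = 1")
      case True
      \<comment> \<open>By parity the block before the last is not the first one, which alone may be
        empty.\<close>
      have "us \<noteq> []" using ev vs by auto
      then have "1 \<le> j'" using pos[of "length us"] ks vs by (cases us) (auto simp: nth_append)
      then obtain j where "j' = Suc j" by (cases j') auto
      then show ?thesis
        using one[of us j] w ks vs ev True block_word_snoc[of "us @ [Suc j]" 1]
        by (simp add: block_word_snoc_Suc)
    next
      case False
      then obtain k' where "k = Suc (Suc k')" using \<open>1 \<le> k\<close> by (metis One_nat_def not0_implies_Suc not_one_le_zero)
      then show ?thesis
        using two[of vs k'] w ks ev by (simp add: block_word_snoc_Suc)
    qed
  qed
qed

section \<open>Residues modulo 4 and the two halves of the result\<close>

lemma binary_word_of_snoc2_mod_4:
  assumes "binary_word_of m n (u @ [d, 1])"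
  shows "m mod 4 = 2 * d + 1"
proof -
  obtain k where n: "n = Suc (Suc k)" using assms by (auto simp: binary_word_of_def)
  have "binary_word_of m (Suc (Suc k)) ((u @ [d]) @ [1])" using assms n by simp
  then obtain m' where "d \<in> {0, 1}" "m = 2 * (2 * m' + d) + 1"
    by (auto simp only: binary_word_of_snoc)
  then show ?thesis by auto
qed

text \<open>Rules out the exceptional branch of \<open>euclidean_design\<close>: the only quotient
  of \<open>(1, 1)\<close> is 1, below the bound in \<open>admissible\<close>.\<close>

lemma realizing_pair_not_1_1:
  assumes "realizing_pair rs (a, b)"
  shows "(a, b) \<noteq> (1, 1)"
  using assms by (auto simp: realizing_pair_def admissible_def partial_quotients_1_1)

text \<open>The image of \<open>(0, 1)\<close> under the design is computed twice, by Stern values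
  and by the Euclidean algorithm.\<close>

lemma euclidean_design_stern:
  assumes "0 < a" "0 < b" "coprime a b" "m < 2 ^ n" "design m n = euclidean_design a b"
  shows "a = stern n m" "b = stern n (2 ^ n - m)" "(a, b) = (1, 1) \<Longrightarrow> (m, n) = (1, 1)"
proof -
  have w: "binary_word_of m n (euclidean_design a b)"
    using binary_word_of_design[OF assms(4)] assms(5) by simp
  show "a = stern n m" "b = stern n (2 ^ n - m)"
    using word_act_stern[OF w] word_act_euclidean_design[OF assms(1-3)] by simp_all
  show "(m, n) = (1, 1)" if "(a, b) = (1, 1)"
    using w that by (auto simp: euclidean_design_def binary_word_of_def)
qed

lemma odd_design:
  assumes "odd m" "m < 2 ^ n" "(m, n) \<noteq> (1, 1)"
  shows "2 \<le> n" "last (design m n) = 1" "length (design m n) = n" "set (design m n) \<subseteq> {0, 1}"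
proof -
  note w = binary_word_of_design[OF assms(2)]
  then show len: "length (design m n) = n" and "set (design m n) \<subseteq> {0, 1}"
    by (auto simp: binary_word_of_def)
  have "n \<noteq> 0" using assms by (intro notI) auto
  moreover have "n \<noteq> 1" using assms by (intro notI) (auto simp: less_2_cases_iff)
  ultimately show "2 \<le> n" by simp
  then obtain k u d where "n = Suc k" "design m n = u @ [d]"
    using len by (cases n; cases "design m n" rule: rev_cases) auto
  then show "last (design m n) = 1"
    using w assms(1) by (auto simp: binary_word_of_snoc)
qed

lemma block_lengths_realizing_pair:
  assumes "odd m" "m < 2 ^ n" "(m, n) \<noteq> (1, 1)" "block_lengths (design m n) ks"
  shows "(m mod 4 = 3 \<longleftrightarrow> 2 \<le> last ks) \<and>
     (m mod 4 = 1 \<longleftrightarrow> last ks = 1) \<and>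
     (m mod 4 = 3 \<longrightarrow>
        (\<exists>!p. realizing_pair ks p) \<and>
        (\<forall>a b. realizing_pair ks (a, b) \<longrightarrow> design m n = euclidean_design a b)) \<and>
     (m mod 4 = 1 \<longrightarrow>
        (let l = length ks; rs = take (l - 2) ks @ [ks ! (l - 2) + 1] in
           (\<exists>!p. realizing_pair rs p) \<and>
           (\<forall>a b. realizing_pair rs (a, b) \<longrightarrow> design m n = euclidean_design a b)))"
proof -
  note w = binary_word_of_design[OF assms(2)]
  note od = odd_design[OF assms(1-3)]
  have odd: "odd (length ks)" and bw: "design m n = block_word ks"
    and pos: "\<And>i. 1 \<le> i \<Longrightarrow> i < length ks \<Longrightarrow> 1 \<le> ks ! i"
    using assms(4) by (auto simp: block_lengths_def)
  have "2 \<le> length (design m n)" using od by simp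
  from assms(4) this od(2) show ?thesis
  proof (cases rule: block_lengths_cases)
    case (two us k)
    have "m mod 4 = 3"
      using binary_word_of_snoc2_mod_4[of m n _ 1] w two(2) by simp
    moreover have "\<exists>!p. realizing_pair ks p"
      using two(1) pos by (intro realizing_pair_ex1) auto
    moreover have "design m n = euclidean_design a b" if "realizing_pair ks (a, b)" for a b
      using realizing_pair_not_1_1[OF that] that odd bw
      by (auto simp: euclidean_design_def realizing_pair_def)
    ultimately show ?thesis using two(1) by auto
  next
    case (one us j)
    \<comment> \<open>The final block of length 1 is dropped and the zero block before it raised by
      one; the even branch of \<open>euclidean_design\<close> undoes both changes.\<close>
    define rs where "rs = us @ [Suc (Suc j)]"
    have rs: "take (length ks - 2) ks @ [ks ! (length ks - 2) + 1] = rs"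
      using one(1) by (simp add: rs_def)
    have "m mod 4 = 1"
      using binary_word_of_snoc2_mod_4[of m n _ 0] w one(2) by simp
    moreover have "1 \<le> rs ! i" if "1 \<le> i" "i < length rs" for i
      using pos[of i] that by (auto simp: rs_def one(1) nth_append split: if_splits)
    then have "\<exists>!p. realizing_pair rs p"
      by (intro realizing_pair_ex1) (auto simp: rs_def)
    moreover have "design m n = euclidean_design a b" if "realizing_pair rs (a, b)" for a b
    proof -
      have "partial_quotients a b = rs" using that by (simp add: realizing_pair_def)
      then have "euclidean_design a b = block_word (us @ [Suc j]) @ [1]"
        using realizing_pair_not_1_1[OF that] one(3)
        by (auto simp: euclidean_design_def rs_def)
      then show ?thesis
        using one(2,3) by (simp add: block_word_snoc_Suc)
    qed
    ultimately show ?thesis using one(1) unfolding Let_def rs by simp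
  qed
qed

theorem theorem3p8:
  shows "(\<forall>a b m n :: nat.
            0 < a \<and> 0 < b \<and> coprime a b \<and> m \<le> 2 ^ n - 1 \<and> design m n = euclidean_design a b \<longrightarrow>
              a = stern n m \<and> b = stern n (2 ^ n - m) \<and>
              ((a, b) = (1, 1) \<longrightarrow> (m, n) = (1, 1)))
       \<and> (\<forall>m n :: nat.
            0 < n \<and> odd m \<and> 1 \<le> m \<and> m \<le> 2 ^ n - 1 \<and> (m, n) \<noteq> (1, 1) \<longrightarrow>
              (\<exists>ks. block_lengths (design m n) ks) \<and>
              (\<forall>ks. block_lengths (design m n) ks \<longrightarrow>
                 (m mod 4 = 3 \<longleftrightarrow> 2 \<le> last ks) \<and>
                 (m mod 4 = 1 \<longleftrightarrow> last ks = 1) \<and>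
                 (m mod 4 = 3 \<longrightarrow>
                    (\<exists>!p. realizing_pair ks p) \<and>
                    (\<forall>a b. realizing_pair ks (a, b) \<longrightarrow> design m n = euclidean_design a b)) \<and>
                 (m mod 4 = 1 \<longrightarrow>
                    (let l = length ks; rs = take (l - 2) ks @ [ks ! (l - 2) + 1] in
                       (\<exists>!p. realizing_pair rs p) \<and>
                       (\<forall>a b. realizing_pair rs (a, b) \<longrightarrow> design m n = euclidean_design a b)))))"
proof -
  have less: "m \<le> 2 ^ n - 1 \<longleftrightarrow> m < 2 ^ n" for m n :: nat
    by (metis One_nat_def Suc_pred less_Suc_eq_le zero_less_numeral zero_less_power)
  show ?thesis
    (is "_ \<and> (\<forall>m n. _ m n \<longrightarrow> _ m n \<and> (\<forall>ks. _ m n ks \<longrightarrow> ?Q m n ks))")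
    unfolding less
  proof (rule conjI; intro allI impI; elim conjE)
    fix a b m n :: nat
    assume "0 < a" "0 < b" "coprime a b" "m < 2 ^ n" "design m n = euclidean_design a b"
    note euclidean_design_stern[OF this]
    then show "a = stern n m \<and> b = stern n (2 ^ n - m) \<and> ((a, b) = (1, 1) \<longrightarrow> (m, n) = (1, 1))"
      by blast
  next
    fix m n :: nat
    assume m: "odd m" "m < 2 ^ n" "(m, n) \<noteq> (1, 1)"
    have "\<exists>ks. block_lengths (design m n) ks"
      using odd_design[OF m] by (intro block_lengths_exists) auto
    then show "(\<exists>ks. block_lengths (design m n) ks) \<and>
        (\<forall>ks. block_lengths (design m n) ks \<longrightarrow> ?Q m n ks)"
      using block_lengths_realizing_pair[OF m] by (intro conjI[OF _ allI[OF impI]]) assumption+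
  qed
qed

end
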